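(* Let $A\in\mathbb{C}_{n,n}$ with $\mathrm{Ind}(A)=k$. Then $A$ is $\mathfrak{m}$-core-EP invertible (i.e. its $\mathfrak{m}$-core-EP inverse $A^{(\mathrm{E})}$ exists) if and only if $$\mathrm{rk}(A^{k})=\mathrm{rk}\big((A^{k})^{\sim}A^{k}\big).$$ Furthermore, in this case, let $r=\mathrm{rk}(A^k)$ and let $U$ be a unitary matrix giving the core-EP decomposition of $A$, i.e. $A=U\begin{bmatrix}T&S\\ 0&N\end{bmatrix}U^{*}$ with $T\in\mathbb{C}_{r,r}$ invertible, $S\in\mathbb{C}_{r,n-r}$, $N\in\mathbb{C}_{n-r,n-r}$ and $N^k=0$, and write $U^{*}GU=\begin{bmatrix}G_1&G_2\\ G_3&G_4\end{bmatrix}$ with $G_1\in\mathbb{C}_{r,r}$. Then $$A^{(\mathrm{E})}=U\begin{bmatrix}T^{-1}G_1^{-1}&0\\ 0&0\end{bmatrix}U^{*}G .$$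
   Context: $\mathbb{C}_{n,n}$ is the set of $n\times n$ complex matrices; $A^*$, $\mathrm{rk}(A)$, $\mathcal{R}(A)$ denote conjugate transpose, rank and column space. $\mathrm{Ind}(A)$ is the smallest positive integer $k$ with $\mathrm{rk}(A^{k+1})=\mathrm{rk}(A^k)$. The Minkowski metric matrix is $G=\begin{bmatrix}1&0\\ 0&-I_{n-1}\end{bmatrix}$ and the Minkowski adjoint of $A$ is $A^{\sim}=GA^*G$. Core-EP decomposition (known): for every $A\in\mathbb{C}_{n,n}$ with $\mathrm{Ind}(A)=k$ and $\mathrm{rk}(A^k)=r$ there is a unitary $U$ with $A=U\begin{bmatrix}T&S\\ 0&N\end{bmatrix}U^{*}$, where $T\in\mathbb{C}_{r,r}$ is invertible and $N^k=0$. Blocks may be empty. For $A$ with $\mathrm{Ind}(A)=k$, the $\mathfrak{m}$-core-EP inverse $A^{(\mathrm{E})}$ of $A$ is the matrix $X\in\mathbb{C}_{n,n}$ (unique if it exists) satisfying $XAX=X$, $XA^{k+1}=A^k$, $(AX)^{\sim}=AX$ and $\mathcal{R}(X)\subseteq\mathcal{R}(A^k)$; $A$ is $\mathfrak{m}$-core-EP invertible if such $X$ exists. *)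

theory Defs
  imports
    "Jordan_Normal_Form.DL_Rank"
    "Jordan_Normal_Form.Gauss_Jordan_Elimination"
    "Jordan_Normal_Form.Schur_Decomposition"
begin

text \<open>
  Elements of \<open>\<complex>\<^sub>n\<^sub>,\<^sub>n\<close> are the members of \<^term>\<open>carrier_mat n n\<close>
  over \<^typ>\<open>complex\<close>; the conjugate transpose is \<^const>\<open>mat_adjoint\<close>.
  Empty (\<open>0\<close>-row or \<open>0\<close>-column) blocks are allowed throughout.
\<close>

definition mat_rank :: "complex mat \<Rightarrow> nat" where
  "mat_rank A = vec_space.rank (dim_row A) A"

definition mat_range :: "complex mat \<Rightarrow> complex vec set" where
  "mat_range A = vec_space.col_space (dim_row A) A"

definition mat_index :: "complex mat \<Rightarrow> nat" where
  "mat_index A = (LEAST k. 0 < k \<and> mat_rank (A ^\<^sub>m (k + 1)) = mat_rank (A ^\<^sub>m k))"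

definition unitary_mat :: "complex mat \<Rightarrow> bool" where
  "unitary_mat U \<longleftrightarrow> square_mat U \<and> inverts_mat U (mat_adjoint U) \<and> inverts_mat (mat_adjoint U) U"

text \<open>
  The inverse of an invertible matrix. For a singular matrix the value is unspecified, so it
  is to be used together with \<^const>\<open>invertible_mat\<close>.
\<close>

definition mat_inv :: "complex mat \<Rightarrow> complex mat" where
  "mat_inv A = the (mat_inverse A)"

text \<open>The size is meant to be positive; for \<open>n = 0\<close> the result is not an \<open>n \<times> n\<close> matrix.\<close>

definition minkowski_metric :: "nat \<Rightarrow> complex mat" where
  "minkowski_metric n =
     four_block_mat (1\<^sub>m 1) (0\<^sub>m 1 (n - 1)) (0\<^sub>m (n - 1) 1) (- 1\<^sub>m (n - 1))"

definition minkowski_adjoint :: "complex mat \<Rightarrow> complex mat" where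
  "minkowski_adjoint A =
     minkowski_metric (dim_row A) * mat_adjoint A * minkowski_metric (dim_row A)"

definition is_m_core_EP_inverse :: "complex mat \<Rightarrow> complex mat \<Rightarrow> bool" where
  "is_m_core_EP_inverse A X \<longleftrightarrow>
     X \<in> carrier_mat (dim_row A) (dim_row A) \<and>
     X * A * X = X \<and>
     X * A ^\<^sub>m (mat_index A + 1) = A ^\<^sub>m mat_index A \<and>
     minkowski_adjoint (A * X) = A * X \<and>
     mat_range X \<subseteq> mat_range (A ^\<^sub>m mat_index A)"

definition m_core_EP_invertible :: "complex mat \<Rightarrow> bool" where
  "m_core_EP_invertible A \<longleftrightarrow> (\<exists>X. is_m_core_EP_inverse A X)"

definition m_core_EP_inverse :: "complex mat \<Rightarrow> complex mat" where
  "m_core_EP_inverse A = (THE X. is_m_core_EP_inverse A X)"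

definition core_EP_decomposition ::
  "complex mat \<Rightarrow> complex mat \<Rightarrow> complex mat \<Rightarrow> complex mat \<Rightarrow> complex mat \<Rightarrow> bool" where
  "core_EP_decomposition A U T S N \<longleftrightarrow>
     (let n = dim_row A; k = mat_index A; r = mat_rank (A ^\<^sub>m k) in
       U \<in> carrier_mat n n \<and> unitary_mat U \<and>
       T \<in> carrier_mat r r \<and> S \<in> carrier_mat r (n - r) \<and> N \<in> carrier_mat (n - r) (n - r) \<and>
       invertible_mat T \<and> N ^\<^sub>m k = 0\<^sub>m (n - r) (n - r) \<and>
       A = U * four_block_mat T S (0\<^sub>m (n - r) r) N * mat_adjoint U)"

end

theory Submission
  imports Defs
begin

text \<open>
  A matrix \<open>X\<close> with \<open>X = A\<^sup>k V\<close> is recovered from \<open>P = A X\<close>, because rank stabilisation gives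
  a \<open>Z\<close> with \<open>Z A\<^sup>k\<^sup>+\<^sup>1 = A\<^sup>k\<close>, hence \<open>X = Z P\<close>. The defining equations say that \<open>P\<close> is
  the \<open>\<sim>\<close>-self-adjoint projector onto the range of \<open>B = A\<^sup>k\<close>; it is unique, and it exists iff
  \<open>B = W B\<^sup>\<sim> B\<close> for some \<open>W\<close> (take \<open>P = W B\<^sup>\<sim>\<close>), i.e. iff \<open>B\<^sup>\<sim> B\<close> has the rank of \<open>B\<close>.

  In the basis given by \<open>U\<close>, \<open>P\<close> has the block rows \<open>(1, Q)\<close> and \<open>(0, 0)\<close>. Self-adjointness means
  \<open>P\<^sup>* H = H P\<close> for \<open>H = U\<^sup>* G U\<close> and yields \<open>G\<^sub>1 Q = G\<^sub>2\<close>; with \<open>H\<^sup>2 = 1\<close> this gives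
  \<open>G\<^sub>1 (G\<^sub>1 + Q G\<^sub>3) = 1\<close>, so \<open>G\<^sub>1\<close> is invertible and \<open>Q = G\<^sub>1\<^sup>-\<^sup>1 G\<^sub>2\<close>.
\<close>

section \<open>Range and rank\<close>

lemma mat_range_eq:
  assumes "A \<in> carrier_mat n m"
  shows "mat_range A = {A *\<^sub>v x | x. x \<in> carrier_vec m}"
  using vec_space.col_space_eq[OF assms] assms mult_mat_vec_carrier[OF assms]
  unfolding mat_range_def by fastforce

lemma col_in_mat_range:
  assumes "A \<in> carrier_mat n m" "j < m"
  shows "col A j \<in> mat_range A"
proof -
  interpret vec_space "TYPE(complex)" n .
  have "col A j \<in> set (cols A)"
    using assms by (auto simp: cols_def)
  then show ?thesis
    using assms cols_dim[of A] span_mem by (auto simp: mat_range_def col_space_def)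
qed

text \<open>Each column of \<open>A\<close> is \<open>C\<close> times some vector; these vectors,
  one per column, form \<open>F\<close>. This turns range inclusions into matrix equations.\<close>

lemma mat_factor_if_range_subset:
  assumes A: "A \<in> carrier_mat n m" and C: "C \<in> carrier_mat n p"
    and sub: "mat_range A \<subseteq> mat_range C"
  obtains F where "F \<in> carrier_mat p m" "A = C * F"
proof -
  have "\<forall>j\<in>{..<m}. \<exists>x. x \<in> carrier_vec p \<and> col A j = C *\<^sub>v x"
    using col_in_mat_range[OF A] sub unfolding mat_range_eq[OF C] by blast
  then obtain x where x: "\<forall>j\<in>{..<m}. x j \<in> carrier_vec p \<and> col A j = C *\<^sub>v x j"
    by (auto simp: bchoice_iff)
  define F where "F = mat_of_cols p (map x [0..<m])"
  have F: "F \<in> carrier_mat p m"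
    unfolding F_def using mat_of_cols_carrier(1)[of p "map x [0..<m]"] by simp
  have colF: "col F j = x j" if "j < m" for j
    unfolding F_def using x that by (subst col_mat_of_cols) auto
  have "A = C * F"
  proof (rule mat_col_eqI)
    fix j assume "j < dim_col (C * F)"
    then have j: "j < m" using F by simp
    then show "col A j = col (C * F) j"
      using x colF[OF j] F C by (simp add: col_mult2[OF C F j])
  qed (use A C F in auto)
  with F show thesis using that by blast
qed

lemma mat_range_mult_subset:
  assumes A: "A \<in> carrier_mat n m" and B: "B \<in> carrier_mat m p"
  shows "mat_range (A * B) \<subseteq> mat_range A"
  using assms unfolding mat_range_eq[OF A] mat_range_eq[OF mult_carrier_mat[OF A B]]
  by (auto simp: assoc_mult_mat_vec[OF A B])

section \<open>Column spaces as subspaces: comparing dimensions\<close>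

context vec_space
begin

text \<open>Collects the side conditions under which the dimension theory of abstract vector spaces
  applies to one column space inside another.\<close>

lemma col_space_nested:
  assumes "A \<in> carrier_mat n m" "B \<in> carrier_mat n p" "col_space A \<subseteq> col_space B"
  shows "VectorSpace.subspace class_ring (col_space A) (vs (col_space B))"
    and "vectorspace class_ring (vs (col_space B))"
    and "vectorspace.fin_dim class_ring (vs (col_space A))"
    and "vectorspace.fin_dim class_ring (vs (col_space B))"
  using nested_subspaces[OF span_is_subspace span_is_subspace, of "set (cols B)" "set (cols A)"]
    subspace_is_vs[OF span_is_subspace, of "set (cols B)"] assms cols_dim[of A] cols_dim[of B]
    fin_dim_span_cols
  unfolding col_space_def by auto

lemma rank_mono:
  assumes "A \<in> carrier_mat n m" "B \<in> carrier_mat n p" "col_space A \<subseteq> col_space B"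
  shows "rank A \<le> rank B"
  using vectorspace.subspace_dim[OF col_space_nested(2,1)[OF assms] col_space_nested(4)[OF assms]]
    col_space_nested(3)[OF assms]
  unfolding rank_def col_space_def by simp

text \<open>A column outside the span of a maximal independent set of columns could be added to it
  without losing independence, so maximality forces the set to span all columns.\<close>

lemma maximal_indpt_subset_of_cols:
  assumes A: "A \<in> carrier_mat n m"
  obtains b where "finite b" "b \<subseteq> set (cols A)" "lin_indpt b" "card b = rank A"
    "set (cols A) \<subseteq> span b"
proof -
  let ?S = "set (cols A)"
  have S: "?S \<subseteq> carrier_vec n" using A cols_dim by blast
  let ?P = "\<lambda>T. T \<subseteq> ?S \<and> lin_indpt T"
  have "lin_indpt {}"
    by (metis fin_dim finite_basis_exists subset_li_is_li vec_vs vectorspace.basis_def empty_subsetI)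
  then obtain b where b: "maximal b ?P" and fb: "finite b"
    using maximal_exists_superset[of ?S ?P "{}"] by auto
  have li: "lin_indpt b" and bS: "b \<subseteq> ?S" using b unfolding maximal_def by auto
  have "?S \<subseteq> span b"
  proof
    fix s assume s: "s \<in> ?S"
    show "s \<in> span b"
    proof (rule ccontr)
      assume ns: "s \<notin> span b"
      have "s \<notin> b" using ns span_mem[of b s] bS S by auto
      moreover have "lin_indpt (b \<union> {s})"
        using lin_dep_iff_in_span[of b s] li bS S s ns \<open>s \<notin> b\<close> by auto
      then have "b \<union> {s} = b" using b bS s unfolding maximal_def by blast
      ultimately show False by auto
    qed
  qed
  with that fb bS li rank_card_indpt[OF A b] show thesis by metis
qed

text \<open>A maximal independent set of columns of \<open>A\<close> lies in the larger column space
  and has as many elements as its dimension, so it is a basis there and the two spaces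
  coincide.\<close>

lemma col_space_subset_if_rank_eq:
  assumes A: "A \<in> carrier_mat n m" and B: "B \<in> carrier_mat n p"
    and sub: "col_space A \<subseteq> col_space B" and eq: "rank A = rank B"
  shows "col_space B \<subseteq> col_space A"
proof -
  note W = col_space_nested[OF A B sub]
  obtain b where b: "finite b" "b \<subseteq> set (cols A)" "lin_indpt b" "card b = rank A"
    using maximal_indpt_subset_of_cols[OF A] .
  have S: "set (cols A) \<subseteq> carrier_vec n" using A cols_dim by blast
  have bA: "b \<subseteq> col_space A" using b(2) in_own_span S unfolding col_space_def by auto
  then have bB: "b \<subseteq> col_space B" using sub by auto
  have sm: "submodule class_ring (col_space B) V"
    unfolding col_space_def using B cols_dim[of B] by (intro span_is_submodule) auto
  \<comment> \<open>Span and independence are the same whether taken in the full space or inside the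
    subspace.\<close>
  note li = span_li_not_depend[OF bB sm]
  have "vectorspace.basis class_ring (vs (col_space B)) b"
    by (rule vectorspace.dim_li_is_basis[OF W(2) W(4) b(1)])
      (use bB b li eq in \<open>auto simp: rank_def col_space_def\<close>)
  then have "col_space B = span b"
    using li vectorspace.basis_def[OF W(2)] by auto
  also have "\<dots> \<subseteq> col_space A"
    unfolding col_space_def using b(2) span_is_monotone by auto
  finally show ?thesis .
qed

end

section \<open>Rank of products and of the transpose\<close>

lemma mat_rank_mono:
  assumes "A \<in> carrier_mat n m" "B \<in> carrier_mat n p" "mat_range A \<subseteq> mat_range B"
  shows "mat_rank A \<le> mat_rank B"
  using vec_space.rank_mono assms unfolding mat_rank_def mat_range_def by auto

lemma mat_rank_le_dim_col: "mat_rank A \<le> dim_col A"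
  unfolding mat_rank_def by (rule vec_space.rank_le_nc) auto

lemma mat_rank_mult_le_left:
  assumes "A \<in> carrier_mat n m" "B \<in> carrier_mat m p"
  shows "mat_rank (A * B) \<le> mat_rank A"
  by (rule mat_rank_mono[OF mult_carrier_mat[OF assms] assms(1) mat_range_mult_subset[OF assms]])

text \<open>The columns of \<open>C\<close> are a maximal independent set of columns of
  \<open>A\<close>: there are \<open>mat_rank A\<close> of them and every column of \<open>A\<close>
  is a combination of them.\<close>

lemma rank_factorization:
  assumes A: "A \<in> carrier_mat n m"
  obtains C F where "C \<in> carrier_mat n (mat_rank A)" "F \<in> carrier_mat (mat_rank A) m" "A = C * F"
proof -
  interpret vec_space "TYPE(complex)" n .
  have S: "set (cols A) \<subseteq> carrier_vec n" using A cols_dim by blast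
  obtain b where b: "finite b" "b \<subseteq> set (cols A)" "card b = rank A" "set (cols A) \<subseteq> span b"
    using maximal_indpt_subset_of_cols[OF A] .
  obtain bs where bs: "set bs = b" "distinct bs" using finite_distinct_list[OF b(1)] by auto
  define C where "C = mat_of_cols n bs"
  have C: "C \<in> carrier_mat n (mat_rank A)"
    unfolding C_def using bs b(3) A distinct_card[OF bs(2)] by (simp add: mat_rank_def)
  have "cols C = bs" unfolding C_def using bs b S by (intro cols_mat_of_cols) auto
  then have "col_space A \<subseteq> col_space C"
    unfolding col_space_def using span_is_subset[OF b(4)] bs b S
    by (simp add: span_is_submodule)
  then have "mat_range A \<subseteq> mat_range C" unfolding mat_range_def using A C by simp
  from mat_factor_if_range_subset[OF A C this] that C show thesis by blast
qed

text \<open>Transposing a rank factorization \<open>A = C * F\<close> leaves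
  \<open>transpose_mat F\<close> as left factor, which has only \<open>mat_rank A\<close> columns.
  Applied twice, this equates row and column rank.\<close>

lemma mat_rank_transpose_le:
  assumes A: "A \<in> carrier_mat n m"
  shows "mat_rank (transpose_mat A) \<le> mat_rank A"
proof -
  from rank_factorization[OF A] obtain C F
    where C: "C \<in> carrier_mat n (mat_rank A)" and F: "F \<in> carrier_mat (mat_rank A) m" and "A = C * F" .
  then have "mat_rank (transpose_mat A) = mat_rank (transpose_mat F * transpose_mat C)"
    by (metis transpose_mult)
  also have "\<dots> \<le> mat_rank (transpose_mat F)"
    by (rule mat_rank_mult_le_left) (use C F in auto)
  also have "\<dots> \<le> mat_rank A" using mat_rank_le_dim_col[of "transpose_mat F"] F by simp
  finally show ?thesis .
qed

lemma mat_rank_transpose: "mat_rank (transpose_mat A) = mat_rank A"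
  using mat_rank_transpose_le[of A] mat_rank_transpose_le[of "transpose_mat A"]
  by (metis carrier_matI le_antisym transpose_transpose)

lemma mat_rank_mult_le_right:
  assumes "A \<in> carrier_mat n m" "B \<in> carrier_mat m p"
  shows "mat_rank (A * B) \<le> mat_rank B"
  using mat_rank_mult_le_left[of "transpose_mat B" p m "transpose_mat A" n] assms
  by (metis mat_rank_transpose transpose_carrier_mat transpose_mult)

text \<open>The range of \<open>A * B\<close> lies in that of \<open>A\<close>; equal ranks make the
  ranges equal, so \<open>A\<close> factors through \<open>A * B\<close>. Hence \<open>Y\<close>
  undoes the multiplication by \<open>B\<close>.\<close>

lemma mat_factor_if_rank_mult_eq_left:
  assumes A: "A \<in> carrier_mat n m" and B: "B \<in> carrier_mat m p"
    and eq: "mat_rank (A * B) = mat_rank A"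
  obtains Y where "Y \<in> carrier_mat p m" "A * B * Y = A"
proof -
  have AB: "A * B \<in> carrier_mat n p" using A B by simp
  have "mat_range A \<subseteq> mat_range (A * B)"
    using vec_space.col_space_subset_if_rank_eq[OF AB A] mat_range_mult_subset[OF A B] eq A
    unfolding mat_range_def mat_rank_def by simp
  then show thesis
    using mat_factor_if_range_subset[OF A AB] that by metis
qed

lemma mat_factor_if_rank_mult_eq_right:
  assumes A: "A \<in> carrier_mat n m" and B: "B \<in> carrier_mat m p"
    and eq: "mat_rank (A * B) = mat_rank B"
  obtains Z where "Z \<in> carrier_mat m n" "Z * (A * B) = B"
proof -
  have "mat_rank (transpose_mat B * transpose_mat A) = mat_rank (transpose_mat B)"
    using eq transpose_mult[OF A B] by (metis mat_rank_transpose)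
  then obtain Y where Y: "Y \<in> carrier_mat n m" "transpose_mat B * transpose_mat A * Y = transpose_mat B"
    using mat_factor_if_rank_mult_eq_left[of "transpose_mat B" p m "transpose_mat A" n] A B by auto
  have "transpose_mat Y * (A * B) = transpose_mat (transpose_mat (A * B) * Y)"
    using transpose_mult[of "transpose_mat (A * B)" p n Y m] A B Y(1) by simp
  also have "\<dots> = B" unfolding transpose_mult[OF A B] Y(2) by simp
  finally show thesis using that[of "transpose_mat Y"] Y(1) by simp
qed

section \<open>Adjoints and block matrices\<close>

lemma mat_adjoint_eq: "mat_adjoint A = mat (dim_col A) (dim_row A) (\<lambda>(i, j). cnj (A $$ (j, i)))"
  by (rule eq_matI) (auto simp: mat_adjoint_def mat_of_rows_index)

lemma mat_adjoint_carrier [simp]: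
  fixes A :: "complex mat"
  shows "A \<in> carrier_mat n m \<Longrightarrow> mat_adjoint A \<in> carrier_mat m n"
  by (auto simp: mat_adjoint_eq)

lemma mat_adjoint_adjoint [simp]: "mat_adjoint (mat_adjoint A) = (A :: complex mat)"
  by (rule eq_matI) (auto simp: mat_adjoint_eq)

lemma mat_adjoint_mult:
  fixes A :: "complex mat"
  assumes "A \<in> carrier_mat n m" "B \<in> carrier_mat m p"
  shows "mat_adjoint (A * B) = mat_adjoint B * mat_adjoint A"
  using assms by (intro eq_matI) (auto simp: mat_adjoint_eq scalar_prod_def mult.commute)

lemma mat_adjoint_four_block_mat:
  fixes A :: "complex mat"
  assumes "A \<in> carrier_mat n1 m1" "B \<in> carrier_mat n1 m2" "C \<in> carrier_mat n2 m1" "D \<in> carrier_mat n2 m2"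
  shows "mat_adjoint (four_block_mat A B C D) =
    four_block_mat (mat_adjoint A) (mat_adjoint C) (mat_adjoint B) (mat_adjoint D)"
  using assms by (intro eq_matI) (auto simp: mat_adjoint_eq)

lemma four_block_mat_eq_iff:
  assumes "A \<in> carrier_mat n1 m1" "B \<in> carrier_mat n1 m2" "C \<in> carrier_mat n2 m1" "D \<in> carrier_mat n2 m2"
    "A' \<in> carrier_mat n1 m1" "B' \<in> carrier_mat n1 m2" "C' \<in> carrier_mat n2 m1" "D' \<in> carrier_mat n2 m2"
  shows "four_block_mat A B C D = four_block_mat A' B' C' D' \<longleftrightarrow> A = A' \<and> B = B' \<and> C = C' \<and> D = D'"
    (is "?M = ?M' \<longleftrightarrow> _")
proof
  assume eq: "?M = ?M'"
  have "A $$ (i, j) = A' $$ (i, j)" if "i < n1" "j < m1" for i j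
    using arg_cong[OF eq, of "\<lambda>M. M $$ (i, j)"] that assms by simp
  moreover have "B $$ (i, j) = B' $$ (i, j)" if "i < n1" "j < m2" for i j
    using arg_cong[OF eq, of "\<lambda>M. M $$ (i, j + m1)"] that assms by simp
  moreover have "C $$ (i, j) = C' $$ (i, j)" if "i < n2" "j < m1" for i j
    using arg_cong[OF eq, of "\<lambda>M. M $$ (i + n1, j)"] that assms by simp
  moreover have "D $$ (i, j) = D' $$ (i, j)" if "i < n2" "j < m2" for i j
    using arg_cong[OF eq, of "\<lambda>M. M $$ (i + n1, j + m1)"] that assms by simp
  ultimately show "A = A' \<and> B = B' \<and> C = C' \<and> D = D'"
    using assms by (auto intro!: eq_matI)
qed simp

lemma four_block_mat_cases:
  assumes "A \<in> carrier_mat (n1 + n2) (m1 + m2)"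
  obtains A1 A2 A3 A4 where "A1 \<in> carrier_mat n1 m1" "A2 \<in> carrier_mat n1 m2"
    "A3 \<in> carrier_mat n2 m1" "A4 \<in> carrier_mat n2 m2" "A = four_block_mat A1 A2 A3 A4"
  using split_block[of A n1 m1 _ _ _ _ n2 m2] assms
  by (cases "split_block A n1 m1") auto

section \<open>Inverses\<close>

lemma invertible_mat_iff:
  assumes "A \<in> carrier_mat n n"
  shows "invertible_mat A \<longleftrightarrow> (\<exists>B \<in> carrier_mat n n. A * B = 1\<^sub>m n \<and> B * A = 1\<^sub>m n)"
proof
  assume "invertible_mat A"
  then obtain B where "A * B = 1\<^sub>m n" "B * A = 1\<^sub>m (dim_row B)"
    using assms unfolding invertible_mat_def inverts_mat_def by auto
  moreover from this have "B \<in> carrier_mat n n"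
    using assms by (metis carrier_matD(2) carrier_matI index_mult_mat(2,3) index_one_mat(2,3))
  ultimately show "\<exists>B \<in> carrier_mat n n. A * B = 1\<^sub>m n \<and> B * A = 1\<^sub>m n" by auto
next
  assume "\<exists>B \<in> carrier_mat n n. A * B = 1\<^sub>m n \<and> B * A = 1\<^sub>m n"
  then show "invertible_mat A"
    using assms unfolding invertible_mat_def inverts_mat_def by auto
qed

lemma mat_inv:
  assumes A: "A \<in> carrier_mat n n" and inv: "invertible_mat A"
  shows "mat_inv A \<in> carrier_mat n n" "A * mat_inv A = 1\<^sub>m n" "mat_inv A * A = 1\<^sub>m n"
proof -
  \<comment> \<open>\<open>mat_inverse\<close> is specified through the units of the matrix ring;
    being a unit excludes the result \<open>None\<close>.\<close>
  have "A \<in> Units (ring_mat TYPE(complex) n ())"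
    using A inv unfolding invertible_mat_iff[OF A] Units_def by (auto simp: ring_mat_def)
  then obtain B where "mat_inverse A = Some B"
    using mat_inverse(1)[OF A, of "()"] by (cases "mat_inverse A") auto
  then show "mat_inv A \<in> carrier_mat n n" "A * mat_inv A = 1\<^sub>m n" "mat_inv A * A = 1\<^sub>m n"
    using mat_inverse(2)[OF A] unfolding mat_inv_def by auto
qed

section \<open>The Minkowski metric and its adjoint\<close>

lemma minkowski_metric_carrier [simp]: "0 < n \<Longrightarrow> minkowski_metric n \<in> carrier_mat n n"
  unfolding minkowski_metric_def by (rule carrier_matI) auto

lemma minkowski_metric_square: "0 < n \<Longrightarrow> minkowski_metric n * minkowski_metric n = 1\<^sub>m n"
  unfolding minkowski_metric_def
  by (subst mult_four_block_mat[of _ 1 1 _ "n - 1" _ "n - 1" _ _ 1 _ "n - 1"]; auto intro!: eq_matI)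

lemma minkowski_metric_adjoint: "mat_adjoint (minkowski_metric n) = minkowski_metric n"
  by (rule eq_matI) (auto simp: mat_adjoint_eq minkowski_metric_def)

lemma minkowski_adjoint_carrier:
  assumes "0 < n" and "A \<in> carrier_mat n n"
  shows "minkowski_adjoint A \<in> carrier_mat n n"
  using assms by (auto simp: minkowski_adjoint_def intro!: mult_carrier_mat[of _ n n])

text \<open>The two inner copies of the metric cancel because it squares to the identity.\<close>

lemma minkowski_adjoint_mult:
  assumes n: "0 < n" and A: "A \<in> carrier_mat n n" and B: "B \<in> carrier_mat n n"
  shows "minkowski_adjoint (A * B) = minkowski_adjoint B * minkowski_adjoint A"
proof -
  let ?G = "minkowski_metric n"
  note assoc = assoc_mult_mat[of _ n n _ n _ n] and mult_carrier = mult_carrier_mat[of _ n n _ n]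
  have G: "?G \<in> carrier_mat n n" and a: "mat_adjoint A \<in> carrier_mat n n"
    and b: "mat_adjoint B \<in> carrier_mat n n" using n A B by auto
  have "minkowski_adjoint B * minkowski_adjoint A
      = ?G * mat_adjoint B * (?G * ?G) * (mat_adjoint A * ?G)"
    using A B G a b by (simp add: minkowski_adjoint_def assoc mult_carrier)
  also have "\<dots> = minkowski_adjoint (A * B)"
    unfolding minkowski_metric_square[OF n]
    using A B G a b
    by (simp add: minkowski_adjoint_def assoc mult_carrier mat_adjoint_mult left_mult_one_mat[of _ n n])
  finally show ?thesis ..
qed

lemma minkowski_adjoint_adjoint:
  assumes n: "0 < n" and A: "A \<in> carrier_mat n n"
  shows "minkowski_adjoint (minkowski_adjoint A) = A"
proof -
  let ?G = "minkowski_metric n"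
  note assoc = assoc_mult_mat[of _ n n _ n _ n] and mult_carrier = mult_carrier_mat[of _ n n _ n]
  have G: "?G \<in> carrier_mat n n" and a: "mat_adjoint A \<in> carrier_mat n n" using n A by auto
  have "mat_adjoint (?G * mat_adjoint A * ?G) = ?G * A * ?G"
    using mat_adjoint_mult[OF mult_carrier[OF G a] G] mat_adjoint_mult[OF G a] G A
    by (simp add: minkowski_metric_adjoint assoc)
  then have "minkowski_adjoint (minkowski_adjoint A) = (?G * ?G) * A * (?G * ?G)"
    using A G by (simp add: minkowski_adjoint_def assoc mult_carrier)
  also have "\<dots> = A" unfolding minkowski_metric_square[OF n] using A by simp
  finally show ?thesis .
qed

section \<open>Index and the m-core-EP inverse\<close>

lemma pow_mat_commute:
  assumes A: "A \<in> carrier_mat n n"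
  shows "A * A ^\<^sub>m k = A ^\<^sub>m k * A"
proof (induction k)
  case (Suc k)
  then show ?case using A assoc_mult_mat[OF A pow_carrier_mat[OF A] A, of k] by simp
qed (use A in auto)

text \<open>The \<open>LEAST\<close> in \<open>mat_index\<close> is attained: otherwise the ranks of
  the powers, from the first on, would strictly decrease forever.\<close>

lemma mat_index_rank:
  assumes A: "A \<in> carrier_mat n n"
  shows "mat_rank (A ^\<^sub>m mat_index A * A) = mat_rank (A ^\<^sub>m mat_index A)"
proof -
  have "\<exists>k. 0 < k \<and> mat_rank (A ^\<^sub>m (k + 1)) = mat_rank (A ^\<^sub>m k)"
  proof (rule ccontr)
    assume "\<nexists>k. 0 < k \<and> mat_rank (A ^\<^sub>m (k + 1)) = mat_rank (A ^\<^sub>m k)"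
    then have less: "mat_rank (A ^\<^sub>m (Suc k)) < mat_rank (A ^\<^sub>m k)" if "0 < k" for k
      using that mat_rank_mult_le_left[OF pow_carrier_mat[OF A] A, of k]
      by (metis Suc_eq_plus1 nat_less_le pow_mat.simps(2))
    have "mat_rank (A ^\<^sub>m (Suc k)) + k \<le> mat_rank (A ^\<^sub>m 1)" for k
    proof (induction k)
      case (Suc k)
      then show ?case using less[of "Suc k"] by linarith
    qed simp
    from this[of "Suc (mat_rank (A ^\<^sub>m 1))"] show False by simp
  qed
  from LeastI_ex[OF this] show ?thesis unfolding mat_index_def by simp
qed

text \<open>Rank stabilisation lets one factor \<open>A\<close> be undone on either side of the
  power: \<open>Y\<close> does so on the right and, since \<open>A\<close> commutes with its powers,
  \<open>Z\<close> on the left.\<close>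

lemma mat_index_factors:
  assumes A: "A \<in> carrier_mat n n"
  obtains Y Z where "Y \<in> carrier_mat n n" "A ^\<^sub>m mat_index A * A * Y = A ^\<^sub>m mat_index A"
    and "Z \<in> carrier_mat n n" "Z * (A * A ^\<^sub>m mat_index A) = A ^\<^sub>m mat_index A"
proof -
  have B: "A ^\<^sub>m mat_index A \<in> carrier_mat n n" using A by simp
  show thesis
    using mat_factor_if_rank_mult_eq_left[OF B A mat_index_rank[OF A]]
      mat_factor_if_rank_mult_eq_right[OF A B] mat_index_rank[OF A] pow_mat_commute[OF A] that
    by metis
qed

section \<open>The projector \<open>A * X\<close>: uniqueness and existence\<close>

context
  fixes n k :: nat and A :: "complex mat"
  assumes n: "0 < n" and A: "A \<in> carrier_mat n n" and k: "mat_index A = k"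
begin

private abbreviation (input) B where "B \<equiv> A ^\<^sub>m k"

private lemmas assoc = assoc_mult_mat[of _ n n _ n _ n]
private lemmas mult_carrier = mult_carrier_mat[of _ n n _ n]
private lemmas adjoint_mult = minkowski_adjoint_mult[OF n]
private lemmas adjoint_adjoint = minkowski_adjoint_adjoint[OF n]
private lemmas adjoint_carrier = minkowski_adjoint_carrier[OF n]

private lemma B: "B \<in> carrier_mat n n" using A by simp

private lemma commute: "A * B = B * A" by (rule pow_mat_commute[OF A])

lemma is_m_core_EP_inverse_iff:
  "is_m_core_EP_inverse A X \<longleftrightarrow> X \<in> carrier_mat n n \<and> X * A * X = X \<and>
     X * (B * A) = B \<and> minkowski_adjoint (A * X) = A * X \<and> (\<exists>V \<in> carrier_mat n n. X = B * V)"
proof -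
  have "mat_range X \<subseteq> mat_range B \<longleftrightarrow> (\<exists>V \<in> carrier_mat n n. X = B * V)"
    if X: "X \<in> carrier_mat n n"
    using mat_factor_if_range_subset[OF X B] mat_range_mult_subset[OF B] by metis
  then show ?thesis unfolding is_m_core_EP_inverse_def k using A by auto
qed

lemma m_core_EP_projector:
  assumes "is_m_core_EP_inverse A X"
  shows "A * X * B = B" and "\<exists>C \<in> carrier_mat n n. A * X = B * C"
proof -
  note X = assms[unfolded is_m_core_EP_inverse_iff]
  then have Xc: "X \<in> carrier_mat n n" and XB: "X * (B * A) = B" by auto
  obtain Y Z where Y: "Y \<in> carrier_mat n n" and BAY: "B * A * Y = B"
    using mat_index_factors[OF A] unfolding k by metis
  \<comment> \<open>Expanding \<open>B\<close> through \<open>Y\<close> produces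
    \<open>X * (B * A)\<close>, which the defining equation collapses to \<open>B\<close>.\<close>
  have "A * X * B = A * X * (B * A * Y)" by (simp only: BAY)
  also have "\<dots> = A * (X * (B * A)) * Y" using A B Xc Y by (simp add: assoc mult_carrier)
  also have "\<dots> = B" unfolding XB commute BAY ..
  finally show "A * X * B = B" .
  obtain V where V: "V \<in> carrier_mat n n" "X = B * V" using X by auto
  have "A * X = A * B * V" using V A B by (simp add: assoc)
  also have "\<dots> = B * (A * V)" unfolding commute using V A B by (simp add: assoc)
  finally show "\<exists>C \<in> carrier_mat n n. A * X = B * C" using A V by (intro bexI[of _ "A * V"]) auto
qed

text \<open>Since \<open>X\<close> begins with \<open>B\<close>, the left factor \<open>Z\<close>
  removes \<open>A\<close> from \<open>A * X\<close>. So \<open>X\<close> is determined by its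
  projector.\<close>

lemma m_core_EP_inverse_recover:
  assumes Z: "Z \<in> carrier_mat n n" "Z * (A * B) = B" and V: "V \<in> carrier_mat n n" "X = B * V"
  shows "X = Z * (A * X)"
proof -
  have "Z * (A * X) = Z * (A * B) * V" using A B Z(1) V by (simp add: assoc mult_carrier)
  then show ?thesis unfolding Z(2) V(2) ..
qed

lemma m_core_EP_inverse_unique:
  assumes X: "is_m_core_EP_inverse A X" and Y: "is_m_core_EP_inverse A Y"
  shows "X = Y"
proof -
  \<comment> \<open>The columns of \<open>A * X\<close> lie in the range of \<open>B\<close>, which
    \<open>A * Y\<close> fixes pointwise.\<close>
  have absorb: "A * Y * (A * X) = A * X"
    if X: "is_m_core_EP_inverse A X" and Y: "is_m_core_EP_inverse A Y" for X Y
  proof -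
    obtain C where C: "C \<in> carrier_mat n n" "A * X = B * C"
      using m_core_EP_projector(2)[OF X] by auto
    have "Y \<in> carrier_mat n n" using Y by (simp add: is_m_core_EP_inverse_iff)
    then have "A * Y * (B * C) = A * Y * B * C" using C(1) A B by (simp add: assoc mult_carrier)
    then show ?thesis unfolding C(2) m_core_EP_projector(1)[OF Y] .
  qed
  note X' = X[unfolded is_m_core_EP_inverse_iff] and Y' = Y[unfolded is_m_core_EP_inverse_iff]
  have c: "A * X \<in> carrier_mat n n" "A * Y \<in> carrier_mat n n" using A X' Y' by auto
  \<comment> \<open>Both projectors are self-adjoint, so the adjoint swaps the product, and
    absorption in the other order turns it into \<open>A * Y\<close>.\<close>
  have "A * X = minkowski_adjoint (A * Y * (A * X))" using absorb[OF X Y] X' by simp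
  also have "\<dots> = A * X * (A * Y)" using adjoint_mult[OF c(2,1)] X' Y' by simp
  also have "\<dots> = A * Y" by (rule absorb[OF Y X])
  finally have eq: "A * X = A * Y" .
  obtain Z where "Z \<in> carrier_mat n n" "Z * (A * B) = B"
    using mat_index_factors[OF A] unfolding k by metis
  then show ?thesis using m_core_EP_inverse_recover X' Y' eq by metis
qed

lemma m_core_EP_invertible_iff:
  "m_core_EP_invertible A \<longleftrightarrow> mat_rank B = mat_rank (minkowski_adjoint B * B)"
proof
  assume "m_core_EP_invertible A"
  then obtain X where X: "is_m_core_EP_inverse A X" unfolding m_core_EP_invertible_def by auto
  obtain C where C: "C \<in> carrier_mat n n" "A * X = B * C"
    using m_core_EP_projector(2)[OF X] by auto
  have c: "minkowski_adjoint B \<in> carrier_mat n n" "minkowski_adjoint C \<in> carrier_mat n n"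
    using adjoint_carrier B C by auto
  \<comment> \<open>Writing the self-adjoint \<open>A * X\<close> as the adjoint of
    \<open>B * C\<close> exhibits \<open>B\<close> as a left multiple of
    \<open>minkowski_adjoint B * B\<close>, which bounds its rank.\<close>
  have "B = A * X * B" using m_core_EP_projector(1)[OF X] ..
  also have "A * X = minkowski_adjoint (B * C)" using X C by (simp add: is_m_core_EP_inverse_iff)
  also have "\<dots> * B = minkowski_adjoint C * (minkowski_adjoint B * B)"
    using c B C by (simp add: adjoint_mult assoc)
  finally have eq: "B = minkowski_adjoint C * (minkowski_adjoint B * B)" .
  have "mat_rank B \<le> mat_rank (minkowski_adjoint B * B)"
    using mat_rank_mult_le_right[OF c(2) mult_carrier[OF c(1) B]]
    unfolding eq[symmetric] .
  moreover have "mat_rank (minkowski_adjoint B * B) \<le> mat_rank B"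
    by (rule mat_rank_mult_le_right[OF c(1) B])
  ultimately show "mat_rank B = mat_rank (minkowski_adjoint B * B)" by simp
next
  let ?B' = "minkowski_adjoint B"
  assume "mat_rank B = mat_rank (?B' * B)"
  then obtain W where W: "W \<in> carrier_mat n n" and WB: "W * (?B' * B) = B"
    using mat_factor_if_rank_mult_eq_right[OF adjoint_carrier[OF B] B] by metis
  let ?W' = "minkowski_adjoint W"
  have c: "?B' \<in> carrier_mat n n" "?W' \<in> carrier_mat n n" using adjoint_carrier B W by auto
  define P where "P = W * ?B'"
  have P: "P \<in> carrier_mat n n" unfolding P_def using W c by auto
  have PB: "P * B = B" unfolding P_def using WB W c B by (simp add: assoc)
  have P': "minkowski_adjoint P = B * ?W'"
    unfolding P_def using W c B by (simp add: adjoint_mult adjoint_adjoint)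
  have P'c: "minkowski_adjoint P \<in> carrier_mat n n" by (rule adjoint_carrier[OF P])
  \<comment> \<open>The adjoint of \<open>P\<close> begins with \<open>B\<close>, which
    \<open>P\<close> fixes. Taking adjoints of this equation then gives self-adjointness, and with
    it idempotence.\<close>
  have PP': "P * minkowski_adjoint P = minkowski_adjoint P"
    unfolding P' using PB assoc[OF P B c(2)] by simp
  have self: "minkowski_adjoint P = P"
    using adjoint_mult[OF P P'c] by (simp add: PP' adjoint_adjoint[OF P])
  have PP: "P * P = P" using PP' self by simp
  obtain Y Z where Y: "Y \<in> carrier_mat n n" "B * A * Y = B"
    and Z: "Z \<in> carrier_mat n n" "Z * (A * B) = B"
    using mat_index_factors[OF A] unfolding k by metis
  \<comment> \<open>Chosen so that \<open>A * X\<close> becomes \<open>B * A * Y * ?W'\<close>, that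
    is \<open>B * ?W'\<close>, the adjoint of \<open>P\<close> and hence \<open>P\<close>.\<close>
  define X where "X = B * (Y * ?W')"
  have V: "Y * ?W' \<in> carrier_mat n n" using Y c by simp
  have X: "X \<in> carrier_mat n n" unfolding X_def using B V by simp
  have "A * X = A * B * Y * ?W'" unfolding X_def using A B Y c by (simp add: assoc mult_carrier)
  also have "\<dots> = P" unfolding commute Y(2) using P' self by simp
  finally have AX: "A * X = P" .
  \<comment> \<open>The form \<open>B * V\<close> gives the range condition; this second form gives
    the two product equations.\<close>
  have XZ: "X = Z * P" using m_core_EP_inverse_recover[OF Z V X_def] AX by simp
  have "X * A * X = X * P" using assoc[OF X A X] AX by simp
  also have "\<dots> = Z * (P * P)" unfolding XZ by (rule assoc[OF Z(1) P P])
  finally have XAX: "X * A * X = X" unfolding PP XZ .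
  have "X * (B * A) = Z * (P * B * A)" unfolding XZ using Z(1) P A B by (simp add: assoc mult_carrier)
  then have XBA: "X * (B * A) = B" unfolding PB commute[symmetric] Z(2) .
  have "is_m_core_EP_inverse A X"
    unfolding is_m_core_EP_inverse_iff AX using X XAX XBA self V X_def by blast
  then show "m_core_EP_invertible A" unfolding m_core_EP_invertible_def by auto
qed

lemma m_core_EP_inverse_eqI:
  "is_m_core_EP_inverse A X \<Longrightarrow> m_core_EP_inverse A = X"
  unfolding m_core_EP_inverse_def using m_core_EP_inverse_unique by (intro the_equality)

end

section \<open>The block formula\<close>

text \<open>Used to cancel the power of \<open>T\<close> from the right when the corner of the
  projector is computed.\<close>

lemma invertible_pow_mat_right_inverse:
  fixes A :: "complex mat"
  assumes A: "A \<in> carrier_mat n n" and inv: "invertible_mat A"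
  shows "\<exists>W \<in> carrier_mat n n. A ^\<^sub>m k * W = 1\<^sub>m n"
proof (induction k)
  case 0
  then show ?case using A by (intro bexI[of _ "1\<^sub>m n"]) auto
next
  case (Suc k)
  then obtain W where W: "W \<in> carrier_mat n n" "A ^\<^sub>m k * W = 1\<^sub>m n" by auto
  note i = mat_inv[OF A inv]
  have "A ^\<^sub>m Suc k * (mat_inv A * W) = A ^\<^sub>m k * ((A * mat_inv A) * W)"
    using A W(1) i(1) by (simp add: assoc_mult_mat[of _ n n _ n _ n] mult_carrier_mat[of _ n n _ n])
  also have "\<dots> = 1\<^sub>m n" using i(2) W by simp
  finally show ?case using i(1) W(1) by (intro bexI[of _ "mat_inv A * W"]) auto
qed

text \<open>The corner \<open>M\<close> is left unspecified, since only the diagonal blocks of the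
  power are needed.\<close>

lemma pow_upper_block_mat:
  fixes T :: "'a :: semiring_1 mat"
  assumes T: "T \<in> carrier_mat r r" and S: "S \<in> carrier_mat r m" and N: "N \<in> carrier_mat m m"
  shows "\<exists>M \<in> carrier_mat r m. four_block_mat T S (0\<^sub>m m r) N ^\<^sub>m k =
    four_block_mat (T ^\<^sub>m k) M (0\<^sub>m m r) (N ^\<^sub>m k)"
proof (induction k)
  case 0
  then show ?case using T N by (intro bexI[of _ "0\<^sub>m r m"]) auto
next
  case (Suc k)
  then obtain M where M: "M \<in> carrier_mat r m" and eq: "four_block_mat T S (0\<^sub>m m r) N ^\<^sub>m k =
    four_block_mat (T ^\<^sub>m k) M (0\<^sub>m m r) (N ^\<^sub>m k)" by auto
  have Tk: "T ^\<^sub>m k \<in> carrier_mat r r" and Nk: "N ^\<^sub>m k \<in> carrier_mat m m" using T N by auto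
  have "four_block_mat T S (0\<^sub>m m r) N ^\<^sub>m Suc k =
      four_block_mat (T ^\<^sub>m Suc k) (T ^\<^sub>m k * S + M * N) (0\<^sub>m m r) (N ^\<^sub>m Suc k)"
    unfolding pow_mat.simps eq
    by (subst mult_four_block_mat[OF Tk M _ Nk T S _ N]) (use T S N M Tk Nk in auto)
  then show ?case using Tk Nk S M N by (intro bexI[of _ "T ^\<^sub>m k * S + M * N"]) auto
qed

lemma upper_block_row_mult:
  fixes A1 :: "'a :: comm_ring_1 mat"
  assumes "A1 \<in> carrier_mat r r" "A2 \<in> carrier_mat r m" "A4 \<in> carrier_mat m m"
    "B1 \<in> carrier_mat r r" "B2 \<in> carrier_mat r m"
  shows "four_block_mat A1 A2 (0\<^sub>m m r) A4 * four_block_mat B1 B2 (0\<^sub>m m r) (0\<^sub>m m m) =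
    four_block_mat (A1 * B1) (A1 * B2) (0\<^sub>m m r) (0\<^sub>m m m)"
  using assms by (subst mult_four_block_mat[of _ r r _ m _ m _ _ r _ m]) auto

lemma top_row_block_mult:
  fixes A1 :: "'a :: comm_ring_1 mat"
  assumes "A1 \<in> carrier_mat r r" "A2 \<in> carrier_mat r m"
    "B1 \<in> carrier_mat r r" "B2 \<in> carrier_mat r m" "B3 \<in> carrier_mat m r" "B4 \<in> carrier_mat m m"
  shows "four_block_mat A1 A2 (0\<^sub>m m r) (0\<^sub>m m m) * four_block_mat B1 B2 B3 B4 =
    four_block_mat (A1 * B1 + A2 * B3) (A1 * B2 + A2 * B4) (0\<^sub>m m r) (0\<^sub>m m m)"
  using assms by (subst mult_four_block_mat[of _ r r _ m _ m _ _ r _ m]) auto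

section \<open>Change of basis by a unitary matrix\<close>

locale unitary_conjugation =
  fixes n :: nat and U :: "complex mat"
  assumes U: "U \<in> carrier_mat n n" and unitary: "unitary_mat U"
begin

text \<open>The matrix of \<open>M\<close> in the orthonormal basis of columns of \<open>U\<close>.
  The map respects products and \<open>mat_adjoint\<close>, but in general not
  \<open>minkowski_adjoint\<close>, since the metric itself is transformed.\<close>

definition conj_by :: "complex mat \<Rightarrow> complex mat" where
  "conj_by M = mat_adjoint U * M * U"

lemmas assoc = assoc_mult_mat[of _ n n _ n _ n]
lemmas mult_carrier = mult_carrier_mat[of _ n n _ n]

lemma U': "mat_adjoint U \<in> carrier_mat n n" using U by simp

lemma UU': "U * mat_adjoint U = 1\<^sub>m n" and U'U: "mat_adjoint U * U = 1\<^sub>m n"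
  using unitary U U' unfolding unitary_mat_def inverts_mat_def by auto

lemma conj_by_carrier: "M \<in> carrier_mat n n \<Longrightarrow> conj_by M \<in> carrier_mat n n"
  unfolding conj_by_def using U U' by (intro mult_carrier)

lemma cancel: "M \<in> carrier_mat n n \<Longrightarrow> U * (mat_adjoint U * M) = M"
  "M \<in> carrier_mat n n \<Longrightarrow> mat_adjoint U * (U * M) = M"
  using assoc[OF U U', of M] assoc[OF U' U, of M] UU' U'U by auto

lemma conj_by_mult:
  assumes "M \<in> carrier_mat n n" "P \<in> carrier_mat n n"
  shows "conj_by (M * P) = conj_by M * conj_by P"
  unfolding conj_by_def using assms U U' by (simp add: assoc mult_carrier cancel)

lemma conj_by_inverse:
  assumes "M \<in> carrier_mat n n"
  shows "U * conj_by M * mat_adjoint U = M" and "conj_by (U * M * mat_adjoint U) = M"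
  unfolding conj_by_def using assms U U' UU' U'U by (simp_all add: assoc mult_carrier cancel)

lemma conj_by_one: "conj_by (1\<^sub>m n) = 1\<^sub>m n"
  unfolding conj_by_def using U U' U'U by (simp add: right_mult_one_mat[of _ n n])

lemma conj_by_pow:
  assumes M: "M \<in> carrier_mat n n"
  shows "conj_by (M ^\<^sub>m k) = conj_by M ^\<^sub>m k"
proof (induction k)
  case 0
  then show ?case using M conj_by_carrier[OF M] conj_by_one by simp
next
  case (Suc k)
  then show ?case using conj_by_mult[OF pow_carrier_mat[OF M] M] by simp
qed

lemma conj_by_adjoint:
  assumes M: "M \<in> carrier_mat n n"
  shows "conj_by (mat_adjoint M) = mat_adjoint (conj_by M)"
proof -
  have "mat_adjoint (conj_by M) = mat_adjoint U * mat_adjoint (mat_adjoint U * M)"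
    unfolding conj_by_def by (rule mat_adjoint_mult[OF mult_carrier[OF U' M] U])
  also have "mat_adjoint (mat_adjoint U * M) = mat_adjoint M * U"
    using mat_adjoint_mult[OF U' M] by simp
  finally show ?thesis unfolding conj_by_def using assoc[OF U' mat_adjoint_carrier[OF M] U] by simp
qed

end

text \<open>Cancelling one copy of the metric leaves an equation between products with
  \<open>mat_adjoint\<close> only, which can be carried through \<open>conj_by\<close>.\<close>

lemma minkowski_self_adjoint_iff:
  assumes n: "0 < n" and M: "M \<in> carrier_mat n n"
  shows "minkowski_adjoint M = M \<longleftrightarrow> mat_adjoint M * minkowski_metric n = minkowski_metric n * M"
proof -
  let ?G = "minkowski_metric n"
  have G: "?G \<in> carrier_mat n n" and a: "mat_adjoint M \<in> carrier_mat n n" using n M by auto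
  note aG = mult_carrier_mat[OF a G]
  have GG: "?G * (?G * P) = P" if "P \<in> carrier_mat n n" for P
    using assoc_mult_mat[OF G G that] minkowski_metric_square[OF n] that by simp
  have "minkowski_adjoint M = ?G * (mat_adjoint M * ?G)"
    unfolding minkowski_adjoint_def using M assoc_mult_mat[OF G a G] by simp
  then show ?thesis using GG[OF aG] GG[OF M] by metis
qed

section \<open>The blocks of the m-core-EP inverse\<close>

lemma m_core_EP_inverse_block_formula:
  fixes A :: "complex mat"
  assumes n: "0 < n" and A: "A \<in> carrier_mat n n" and k: "mat_index A = k"
    and X: "is_m_core_EP_inverse A X"
    and r: "r = mat_rank (A ^\<^sub>m k)" and dec: "core_EP_decomposition A U T S N"
    and G1: "G1 \<in> carrier_mat r r" and G2: "G2 \<in> carrier_mat r (n - r)"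
    and G3: "G3 \<in> carrier_mat (n - r) r" and G4: "G4 \<in> carrier_mat (n - r) (n - r)"
    and H: "mat_adjoint U * minkowski_metric n * U = four_block_mat G1 G2 G3 G4"
  shows "invertible_mat G1"
    and "X = U * four_block_mat (mat_inv T * mat_inv G1) (0\<^sub>m r (n - r))
                                (0\<^sub>m (n - r) r) (0\<^sub>m (n - r) (n - r))
               * mat_adjoint U * minkowski_metric n"
proof -
  define m where "m = n - r"
  \<comment> \<open>The rank is at most \<open>n\<close>, so the natural subtraction
    \<open>n - r\<close> does not truncate.\<close>
  have rm: "r + m = n" using mat_rank_le_dim_col[of "A ^\<^sub>m k"] A r unfolding m_def
    by (simp split: if_splits)
  note G = G1 G2[folded m_def] G3[folded m_def] G4[folded m_def]
  let ?G = "minkowski_metric n" and ?Z1 = "0\<^sub>m m r :: complex mat" and ?Z = "0\<^sub>m m m :: complex mat"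
  let ?A' = "four_block_mat T S ?Z1 N"
  have dims: "dim_row A = n" using A by simp
  have U: "U \<in> carrier_mat n n" and uni: "unitary_mat U"
    and T: "T \<in> carrier_mat r r" and S: "S \<in> carrier_mat r m" and N: "N \<in> carrier_mat m m"
    and invT: "invertible_mat T" and Nk: "N ^\<^sub>m k = ?Z"
    and AU: "A = U * ?A' * mat_adjoint U"
    using dec unfolding core_EP_decomposition_def Let_def dims k r[symmetric] m_def[symmetric] by auto
  interpret unitary_conjugation n U by unfold_locales (use U uni in auto)
  have A': "?A' \<in> carrier_mat n n" using T N rm by (metis four_block_carrier_mat)
  have G': "?G \<in> carrier_mat n n" using n by simp
  have cA: "conj_by A = ?A'" unfolding AU by (rule conj_by_inverse(2)[OF A'])
  have cG: "conj_by ?G = four_block_mat G1 G2 G3 G4" unfolding conj_by_def by (rule H)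
  obtain M where M: "M \<in> carrier_mat r m"
    and cB: "conj_by (A ^\<^sub>m k) = four_block_mat (T ^\<^sub>m k) M ?Z1 ?Z"
    using pow_upper_block_mat[OF T S N, of k] unfolding conj_by_pow[OF A] cA Nk by auto
  have Tk: "T ^\<^sub>m k \<in> carrier_mat r r" and B: "A ^\<^sub>m k \<in> carrier_mat n n" using T A by auto
  note X' = X[unfolded is_m_core_EP_inverse_iff[OF n A k]]
  have Xc: "X \<in> carrier_mat n n" using X' by simp
  \<comment> \<open>As \<open>N ^\<^sub>m k\<close> vanishes, the lower block row of the power is
    zero, and \<open>X\<close>, a right multiple of the power, inherits this.\<close>
  obtain X1 X2 where X1: "X1 \<in> carrier_mat r r" and X2: "X2 \<in> carrier_mat r m"
    and cX: "conj_by X = four_block_mat X1 X2 ?Z1 ?Z"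
  proof -
    obtain V where V: "V \<in> carrier_mat n n" "X = A ^\<^sub>m k * V" using X' by auto
    obtain V1 V2 V3 V4 where V': "V1 \<in> carrier_mat r r" "V2 \<in> carrier_mat r m"
      "V3 \<in> carrier_mat m r" "V4 \<in> carrier_mat m m" "conj_by V = four_block_mat V1 V2 V3 V4"
      using four_block_mat_cases[of "conj_by V" r m r m] conj_by_carrier[OF V(1)] unfolding rm by metis
    have "conj_by X = four_block_mat (T ^\<^sub>m k * V1 + M * V3) (T ^\<^sub>m k * V2 + M * V4) ?Z1 ?Z"
      unfolding V(2) conj_by_mult[OF B V(1)] cB V'(5) by (rule top_row_block_mult[OF Tk M V'(1-4)])
    with that show thesis using Tk M V'(1-4) by (metis add_carrier_mat mult_carrier_mat)
  qed
  define Q where "Q = T * X2"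
  have Q: "Q \<in> carrier_mat r m" unfolding Q_def using T X2 by simp
  have AX: "A * X \<in> carrier_mat n n" using A Xc by simp
  have cAX: "conj_by (A * X) = four_block_mat (T * X1) Q ?Z1 ?Z"
    unfolding conj_by_mult[OF A Xc] cA cX Q_def by (rule upper_block_row_mult[OF T S N X1 X2])
  have TX1: "T * X1 = 1\<^sub>m r"
  proof -
    have c: "T * X1 \<in> carrier_mat r r" using T X1 by simp
    \<comment> \<open>The projector fixes the power; the upper left block of this equation allows
      the invertible \<open>T ^\<^sub>m k\<close> to be cancelled.\<close>
    have "conj_by (A * X) * conj_by (A ^\<^sub>m k) = conj_by (A ^\<^sub>m k)"
      using conj_by_mult[OF AX B] m_core_EP_projector(1)[OF n A k X] by simp
    then have "four_block_mat (T * X1 * T ^\<^sub>m k + Q * ?Z1) (T * X1 * M + Q * ?Z) ?Z1 ?Z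
        = four_block_mat (T ^\<^sub>m k) M ?Z1 ?Z"
      unfolding cAX cB using top_row_block_mult[OF c Q Tk M, of ?Z1 ?Z] by simp
    then have eq: "T * X1 * T ^\<^sub>m k = T ^\<^sub>m k"
      by (subst (asm) four_block_mat_eq_iff[of _ r r _ m _ m]) (use c Q Tk M in auto)
    obtain W where W: "W \<in> carrier_mat r r" "T ^\<^sub>m k * W = 1\<^sub>m r"
      using invertible_pow_mat_right_inverse[OF T invT] by metis
    have "T * X1 = T * X1 * (T ^\<^sub>m k * W)" unfolding W(2) using right_mult_one_mat[OF c] ..
    also have "\<dots> = T * X1 * T ^\<^sub>m k * W" using assoc_mult_mat[OF c Tk W(1)] by simp
    finally show ?thesis unfolding eq W(2) .
  qed
  have G1Q: "G1 * Q = G2"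
  proof -
    have one: "mat_adjoint (1\<^sub>m r :: complex mat) = 1\<^sub>m r"
      and zero: "mat_adjoint ?Z1 = 0\<^sub>m r m" "mat_adjoint ?Z = ?Z"
      by (auto simp: mat_adjoint_eq intro!: eq_matI)
    have aQ: "mat_adjoint Q \<in> carrier_mat m r" using Q by simp
    have "mat_adjoint (A * X) * ?G = ?G * (A * X)"
      using minkowski_self_adjoint_iff[OF n AX] X' by simp
    then have "mat_adjoint (conj_by (A * X)) * conj_by ?G = conj_by ?G * conj_by (A * X)"
      using conj_by_mult[OF mat_adjoint_carrier[OF AX] G'] conj_by_mult[OF G' AX]
        conj_by_adjoint[OF AX] by simp
    moreover have "mat_adjoint (conj_by (A * X)) = four_block_mat (1\<^sub>m r) (0\<^sub>m r m) (mat_adjoint Q) ?Z"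
      unfolding cAX TX1
      by (subst mat_adjoint_four_block_mat[of _ r r _ m _ m]) (use Q in \<open>auto simp: one zero\<close>)
    moreover have "four_block_mat (1\<^sub>m r) (0\<^sub>m r m) (mat_adjoint Q) ?Z * four_block_mat G1 G2 G3 G4
        = four_block_mat G1 G2 (mat_adjoint Q * G1) (mat_adjoint Q * G2)"
      by (subst mult_four_block_mat[of _ r r _ m _ m _ _ r _ m]) (use G aQ in auto)
    moreover have "four_block_mat G1 G2 G3 G4 * four_block_mat (1\<^sub>m r) Q ?Z1 ?Z
        = four_block_mat G1 (G1 * Q) G3 (G3 * Q)"
      by (subst mult_four_block_mat[of _ r r _ m _ m _ _ r _ m]) (use G Q in auto)
    ultimately have "four_block_mat G1 G2 (mat_adjoint Q * G1) (mat_adjoint Q * G2)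
        = four_block_mat G1 (G1 * Q) G3 (G3 * Q)"
      unfolding cG cAX TX1 by simp
    \<comment> \<open>The upper right blocks of the self-adjointness equation give the
      claim.\<close>
    then show ?thesis
      by (subst (asm) four_block_mat_eq_iff[of _ r r _ m _ m])
        (use G Q mult_carrier_mat[OF aQ G(1)] mult_carrier_mat[OF aQ G(2)] in auto)
  qed
  show inv: "invertible_mat G1"
  proof -
    have "conj_by ?G * conj_by ?G = 1\<^sub>m n"
      using conj_by_mult[OF G' G'] minkowski_metric_square[OF n] conj_by_one by simp
    also have "\<dots> = four_block_mat (1\<^sub>m r) (0\<^sub>m r m) ?Z1 (1\<^sub>m m)" using rm by simp
    finally have "four_block_mat (G1 * G1 + G2 * G3) (G1 * G2 + G2 * G4) (G3 * G1 + G4 * G3)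
        (G3 * G2 + G4 * G4) = four_block_mat (1\<^sub>m r) (0\<^sub>m r m) ?Z1 (1\<^sub>m m)"
      unfolding cG by (subst (asm) mult_four_block_mat[OF G G])
    then have "G1 * G1 + G2 * G3 = 1\<^sub>m r"
      by (subst (asm) four_block_mat_eq_iff[of _ r r _ m _ m]) (use G in auto)
    \<comment> \<open>Substituting \<open>G1 * Q\<close> for \<open>G2\<close> in the upper left
      block of the squared metric factors out \<open>G1\<close>; a one-sided inverse of a square
      matrix is two-sided.\<close>
    then have "G1 * (G1 + Q * G3) = 1\<^sub>m r"
      using mult_add_distrib_mat[OF G(1) G(1), of "Q * G3"] assoc_mult_mat[OF G(1) Q G(3)] Q G
      by (simp add: G1Q)
    moreover have c: "G1 + Q * G3 \<in> carrier_mat r r" using Q G by simp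
    ultimately show ?thesis
      unfolding invertible_mat_iff[OF G(1)] using mat_mult_left_right_inverse[OF G(1) c] by auto
  qed
  note iT = mat_inv[OF T invT] and iG = mat_inv[OF G(1) inv]
  let ?K = "four_block_mat (mat_inv T * mat_inv G1) (0\<^sub>m r m) ?Z1 ?Z"
  have TG: "mat_inv T * mat_inv G1 \<in> carrier_mat r r" using iT iG by simp
  have K: "?K \<in> carrier_mat n n" using TG rm by (metis four_block_carrier_mat zero_carrier_mat)
  have "X1 = mat_inv T"
    using assoc_mult_mat[OF iT(1) T X1] unfolding iT(3) TX1 using X1 iT(1) by simp
  moreover have "X2 = mat_inv T * Q"
    using assoc_mult_mat[OF iT(1) T X2] unfolding iT(3) Q_def using X2 by simp
  moreover have "Q = mat_inv G1 * G2"
    using assoc_mult_mat[OF iG(1) G(1) Q] unfolding iG(3) G1Q using Q by simp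
  \<comment> \<open>The top row of the product is \<open>mat_inv T * mat_inv G1\<close> times
    \<open>G1\<close> and \<open>G2\<close>, that is \<open>mat_inv T\<close> and
    \<open>mat_inv T * Q\<close>.\<close>
  ultimately have "conj_by X = ?K * conj_by ?G"
    unfolding cX cG
    by (subst top_row_block_mult[OF TG _ G])
      (use iT iG G T assoc_mult_mat[OF iT(1) iG(1) G(1)] assoc_mult_mat[OF iT(1) iG(1) G(2)] in auto)
  then have "X = U * (?K * conj_by ?G) * mat_adjoint U"
    using conj_by_inverse(1)[OF Xc] by simp
  also have "\<dots> = U * ?K * mat_adjoint U * ?G"
    unfolding conj_by_def using U U' K G' UU' by (simp add: assoc mult_carrier)
  finally show "X = U * four_block_mat (mat_inv T * mat_inv G1) (0\<^sub>m r (n - r))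
        (0\<^sub>m (n - r) r) (0\<^sub>m (n - r) (n - r)) * mat_adjoint U * ?G"
    unfolding m_def .
qed

theorem theorem2p3:
  fixes A :: "complex mat" and n k :: nat
  assumes "0 < n"
    and "A \<in> carrier_mat n n"
    and "mat_index A = k"
  shows "(m_core_EP_invertible A \<longleftrightarrow>
            mat_rank (A ^\<^sub>m k) = mat_rank (minkowski_adjoint (A ^\<^sub>m k) * A ^\<^sub>m k)) \<and>
         (m_core_EP_invertible A \<longrightarrow>
            (\<forall>r U T S N G1 G2 G3 G4.
               r = mat_rank (A ^\<^sub>m k) \<longrightarrow>
               core_EP_decomposition A U T S N \<longrightarrow>
               G1 \<in> carrier_mat r r \<longrightarrow>
               G2 \<in> carrier_mat r (n - r) \<longrightarrow>
               G3 \<in> carrier_mat (n - r) r \<longrightarrow>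
               G4 \<in> carrier_mat (n - r) (n - r) \<longrightarrow>
               mat_adjoint U * minkowski_metric n * U = four_block_mat G1 G2 G3 G4 \<longrightarrow>
               invertible_mat G1 \<and>
               m_core_EP_inverse A =
                 U * four_block_mat (mat_inv T * mat_inv G1) (0\<^sub>m r (n - r))
                                    (0\<^sub>m (n - r) r) (0\<^sub>m (n - r) (n - r))
                   * mat_adjoint U * minkowski_metric n))"
proof (intro conjI impI allI)
  show "m_core_EP_invertible A \<longleftrightarrow>
      mat_rank (A ^\<^sub>m k) = mat_rank (minkowski_adjoint (A ^\<^sub>m k) * A ^\<^sub>m k)"
    by (rule m_core_EP_invertible_iff[OF assms])
next
  fix r U T S N G1 G2 G3 G4
  assume "m_core_EP_invertible A"
  \<comment> \<open>Uniqueness makes the \<open>THE\<close> in \<open>m_core_EP_inverse\<close>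
    denote the existing inverse, so the formula for an arbitrary inverse applies to it.\<close>
  then have X: "is_m_core_EP_inverse A (m_core_EP_inverse A)"
    unfolding m_core_EP_invertible_def using m_core_EP_inverse_eqI[OF assms] by auto
  note formula = m_core_EP_inverse_block_formula[OF assms X]
  assume "r = mat_rank (A ^\<^sub>m k)" and "core_EP_decomposition A U T S N"
    and "G1 \<in> carrier_mat r r" and "G2 \<in> carrier_mat r (n - r)"
    and "G3 \<in> carrier_mat (n - r) r" and "G4 \<in> carrier_mat (n - r) (n - r)"
    and "mat_adjoint U * minkowski_metric n * U = four_block_mat G1 G2 G3 G4"
  note formula = formula[OF this]
  show "invertible_mat G1" by (rule formula(1))
  show "m_core_EP_inverse A =
      U * four_block_mat (mat_inv T * mat_inv G1) (0\<^sub>m r (n - r))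
                         (0\<^sub>m (n - r) r) (0\<^sub>m (n - r) (n - r))
        * mat_adjoint U * minkowski_metric n"
    by (rule formula(2))
qed

end
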